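(* Let $\mathcal{T}$ be the density topology on $\mathbf{R}$ and let $A \subseteq \mathbf{R}$ be an arbitrary subset, equipped with the subspace topology inherited from $(\mathbf{R},\mathcal{T})$. The following conditions are equivalent: (1) $A$ is weakly hereditarily pseudocompact. (2) $A$ is $N$-pseudocompact. (3) $A$ is finite. Moreover, the equivalence also holds with (1) replaced by: (1$'$) $A$ is hereditarily pseudocompact.
   Context: Density topology: let $m$ denote Lebesgue measure. A Lebesgue measurable set $E \subseteq \mathbf{R}$ has density $d$ at $x \in \mathbf{R}$ if $\lim_{h \to 0^+} \frac{m(E \cap [x-h,x+h])}{2h}$ exists and equals $d$. Let $\phi(E)$ be the set of $x\in\mathbf{R}$ at which $E$ has density $1$. The open sets of the density topology $\mathcal{T}$ on $\mathbf{R}$ are the measurable sets $E$ with $E \subseteq \phi(E)$. A topological space is pseudocompact if every continuous real-valued function on it is bounded. A pseudocompact space $X$ is called weakly hereditarily pseudocompact if every closed subspace of $X$ is pseudocompact; it is called $N$-pseudocompact if every nowhere dense subspace of $X$ (nowhere dense in $X$) is pseudocompact. A space is hereditarily pseudocompact if every subspace of it is pseudocompact. *)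

theory Defs
  imports "HOL-Analysis.Analysis"
begin

subsection \<open>The density topology\<close>

definition has_density :: "real set \<Rightarrow> real \<Rightarrow> real \<Rightarrow> bool" where
  "has_density E d x \<longleftrightarrow>
     ((\<lambda>h. measure lebesgue (E \<inter> {x - h..x + h}) / (2 * h)) \<longlongrightarrow> d) (at_right 0)"

definition density_points :: "real set \<Rightarrow> real set" where
  "density_points E = {x. has_density E 1 x}"

definition density_open :: "real set \<Rightarrow> bool" where
  "density_open E \<longleftrightarrow> E \<in> sets lebesgue \<and> E \<subseteq> density_points E"

definition density_topology :: "real topology" where
  "density_topology = topology density_open"

text \<open>The constant \<^const>\<open>topology\<close> is only meaningful on predicates satisfying
  \<^const>\<open>istopology\<close>. The following lemmas establish this for \<^const>\<open>density_open\<close>; the point is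
  the Lebesgue measurability of arbitrary (uncountable) unions.\<close>

lemma lmeasurable_Int_interval:
  fixes E :: "real set"
  assumes "E \<in> sets lebesgue"
  shows "E \<inter> {a..b} \<in> lmeasurable"
  by (rule fmeasurableI2[of "{a..b}"]) (use assms in auto)

lemma measure_interval_le:
  assumes "E \<in> sets lebesgue" "h > 0"
  shows "measure lebesgue (E \<inter> {x - h..x + h}) \<le> 2 * h"
proof -
  have "measure lebesgue (E \<inter> {x - h..x + h}) \<le> measure lebesgue {x - h..x + h}"
    using assms by (intro measure_mono_fmeasurable) auto
  then show ?thesis using assms by simp
qed

lemma has_density_1I:
  assumes "E \<in> sets lebesgue"
    and low: "\<And>h. h > 0 \<Longrightarrow> g h \<le> measure lebesgue (E \<inter> {x - h..x + h}) / (2 * h)"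
    and g: "(g \<longlongrightarrow> 1) (at_right 0)"
  shows "has_density E 1 x"
  unfolding has_density_def
proof (rule tendsto_sandwich[OF _ _ g tendsto_const])
  show "\<forall>\<^sub>F h in at_right 0. g h \<le> measure lebesgue (E \<inter> {x - h..x + h}) / (2 * h)"
    using low by (auto simp: eventually_at_right_less intro: eventually_mono[OF eventually_at_right_less])
  show "\<forall>\<^sub>F h in at_right 0. measure lebesgue (E \<inter> {x - h..x + h}) / (2 * h) \<le> 1"
    using measure_interval_le[OF assms(1)]
    by (auto intro!: eventually_mono[OF eventually_at_right_less] simp: divide_le_eq)
qed

lemma density_points_mono:
  assumes "E \<subseteq> F" "E \<in> sets lebesgue" "F \<in> sets lebesgue"
  shows "density_points E \<subseteq> density_points F"
proof
  fix x assume "x \<in> density_points E"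
  then have lim: "((\<lambda>h. measure lebesgue (E \<inter> {x - h..x + h}) / (2 * h)) \<longlongrightarrow> 1) (at_right 0)"
    by (simp add: density_points_def has_density_def)
  have "measure lebesgue (E \<inter> {x - h..x + h}) / (2 * h)
      \<le> measure lebesgue (F \<inter> {x - h..x + h}) / (2 * h)" if "h > 0" for h
    using assms that lmeasurable_Int_interval
    by (intro divide_right_mono measure_mono_fmeasurable) auto
  from has_density_1I[OF assms(3) this lim] show "x \<in> density_points F"
    by (simp add: density_points_def)
qed

lemma density_open_Int:
  assumes "density_open E" "density_open F"
  shows "density_open (E \<inter> F)"
proof -
  have EF: "E \<in> sets lebesgue" "F \<in> sets lebesgue"
    using assms by (auto simp: density_open_def)
  have "has_density (E \<inter> F) 1 x" if "x \<in> E" "x \<in> F" for x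
  proof -
    let ?q = "\<lambda>G h. measure lebesgue (G \<inter> {x - h..x + h}) / (2 * h)"
    have "(?q E \<longlongrightarrow> 1) (at_right 0)" "(?q F \<longlongrightarrow> 1) (at_right 0)"
      using assms that by (auto simp: density_open_def density_points_def has_density_def)
    then have "((\<lambda>h. ?q E h + ?q F h - 1) \<longlongrightarrow> 1 + 1 - 1) (at_right 0)"
      by (intro tendsto_intros)
    then have lim: "((\<lambda>h. ?q E h + ?q F h - 1) \<longlongrightarrow> 1) (at_right 0)"
      by simp
    have "?q E h + ?q F h - 1 \<le> ?q (E \<inter> F) h" if h: "h > 0" for h
    proof -
      let ?I = "{x - h..x + h}"
      have fm: "G \<inter> ?I \<in> lmeasurable" if "G \<in> sets lebesgue" for G
        using that by (rule lmeasurable_Int_interval)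
      have "measure lebesgue ((E \<inter> ?I) \<union> (F \<inter> ?I))
          = measure lebesgue (E \<inter> ?I) + measure lebesgue (F \<inter> ?I)
            - measure lebesgue ((E \<inter> ?I) \<inter> (F \<inter> ?I))"
        by (rule measure_Un3) (use fm EF in auto)
      moreover have "(E \<inter> ?I) \<union> (F \<inter> ?I) = (E \<union> F) \<inter> ?I" "(E \<inter> ?I) \<inter> (F \<inter> ?I) = (E \<inter> F) \<inter> ?I"
        by auto
      moreover have "measure lebesgue ((E \<union> F) \<inter> ?I) \<le> 2 * h"
        using EF h by (intro measure_interval_le) auto
      ultimately have "measure lebesgue (E \<inter> ?I) + measure lebesgue (F \<inter> ?I) - 2 * h
          \<le> measure lebesgue ((E \<inter> F) \<inter> ?I)"
        by simp
      then have "(measure lebesgue (E \<inter> ?I) + measure lebesgue (F \<inter> ?I) - 2 * h) / (2 * h)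
          \<le> ?q (E \<inter> F) h"
        using h by (intro divide_right_mono) auto
      then show ?thesis
        using h by (simp add: diff_divide_distrib add_divide_distrib)
    qed
    from has_density_1I[OF sets.Int[OF EF] this lim] show ?thesis .
  qed
  then show ?thesis
    using EF by (auto simp: density_open_def density_points_def)
qed

lemma maximal_measurable_subset:
  fixes E D :: "real set"
  assumes D: "D \<in> lmeasurable"
  obtains B where "B \<subseteq> E \<inter> D" "B \<in> lmeasurable"
    "\<And>C. C \<subseteq> E \<inter> D \<Longrightarrow> C \<in> sets lebesgue \<Longrightarrow> negligible (C - B)"
proof -
  let ?M = "{C. C \<subseteq> E \<inter> D \<and> C \<in> sets lebesgue}"
  define s where "s = Sup (measure lebesgue ` ?M)"
  have fm: "C \<in> lmeasurable" if "C \<in> ?M" for C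
    using that D fmeasurableI2[of D lebesgue C] by auto
  have bdd: "bdd_above (measure lebesgue ` ?M)"
  proof (intro bdd_aboveI2)
    fix C assume "C \<in> ?M"
    then show "measure lebesgue C \<le> measure lebesgue D"
      using D by (intro measure_mono_fmeasurable) auto
  qed
  have upper: "measure lebesgue C \<le> s" if "C \<in> ?M" for C
    unfolding s_def using bdd that by (intro cSup_upper) auto
  have "\<exists>C\<in>?M. s - 1 / Suc n < measure lebesgue C" for n
  proof -
    have "\<exists>y\<in>measure lebesgue ` ?M. s - 1 / Suc n < y"
      unfolding s_def by (rule less_cSupD) auto
    then show ?thesis by auto
  qed
  then obtain C where C: "\<And>n. C n \<in> ?M" "\<And>n. s - 1 / Suc n < measure lebesgue (C n)"
    by metis
  define B where "B = (\<Union>n. C n)"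
  have BM: "B \<in> ?M" using C(1) unfolding B_def by auto
  have "s - 1 / Suc n < measure lebesgue B" for n
  proof -
    have "measure lebesgue (C n) \<le> measure lebesgue B"
      using C(1)[of n] fm[OF BM] by (intro measure_mono_fmeasurable) (auto simp: B_def)
    with C(2)[of n] show ?thesis by linarith
  qed
  then have sB: "s \<le> measure lebesgue B"
    by (metis diff_less_eq field_le_epsilon nat_approx_posE less_add_same_cancel1 add_less_cancel_left
        less_eq_real_def order_less_trans)
  show thesis
  proof
    show "B \<subseteq> E \<inter> D" using BM by auto
    show "B \<in> lmeasurable" using fm BM by blast
    fix F assume F: "F \<subseteq> E \<inter> D" "F \<in> sets lebesgue"
    then have FM: "F \<union> B \<in> ?M" "F - B \<in> ?M" using BM by auto
    have "measure lebesgue (B \<union> (F - B)) = measure lebesgue B + measure lebesgue (F - B)"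
      using fm[OF BM] fm[OF FM(2)] by (intro measure_Un2[THEN trans]) (auto simp: Diff_Int_distrib)
    then have "measure lebesgue (F \<union> B) = measure lebesgue B + measure lebesgue (F - B)"
      by (simp add: Un_commute)
    then have "measure lebesgue (F - B) = 0"
      using upper[OF FM(1)] sB measure_nonneg[of lebesgue "F - B"] by linarith
    then show "negligible (F - B)"
      using fm[OF FM(2)] by (simp add: negligible_iff_measure)
  qed
qed

lemma density_open_Union_measurable:
  assumes K: "\<And>E. E \<in> K \<Longrightarrow> density_open E"
  shows "\<Union>K \<in> sets lebesgue"
proof -
  have meas: "\<Union>K \<inter> ball 0 r \<in> sets lebesgue" for r :: real
  proof -
    let ?D = "ball 0 r :: real set"
    obtain B where B: "B \<subseteq> \<Union>K \<inter> ?D" "B \<in> lmeasurable"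
      and max: "\<And>C. C \<subseteq> \<Union>K \<inter> ?D \<Longrightarrow> C \<in> sets lebesgue \<Longrightarrow> negligible (C - B)"
      by (rule maximal_measurable_subset[of ?D "\<Union>K"]) auto
    have "negligible (\<Union>K \<inter> ?D - B)"
      unfolding negligible_eq_zero_density_alt
    proof (intro ballI allI impI)
      fix x e :: real
      assume x: "x \<in> \<Union>K \<inter> ?D - B" and e: "e > 0"
      then obtain E where E: "E \<in> K" "x \<in> E" by auto
      have Em: "E \<in> sets lebesgue" using K[OF E(1)] by (simp add: density_open_def)
      have "((\<lambda>h. measure lebesgue (E \<inter> {x - h..x + h}) / (2 * h)) \<longlongrightarrow> 1) (at_right 0)"
        using K[OF E(1)] E(2) by (auto simp: density_open_def density_points_def has_density_def)
      then have "\<forall>\<^sub>F h in at_right 0. measure lebesgue (E \<inter> {x - h..x + h}) / (2 * h) > 1 - e"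
        using e by (intro order_tendstoD) auto
      then obtain b where b: "b > 0"
        "\<And>h. 0 < h \<Longrightarrow> h < b \<Longrightarrow> measure lebesgue (E \<inter> {x - h..x + h}) / (2 * h) > 1 - e"
        by (auto simp: eventually_at_right[OF zero_less_one])
      have "x \<in> ?D" using x by auto
      then obtain k where k: "k > 0" "ball x k \<subseteq> ?D"
        using open_contains_ball by blast
      define h where "h = min (min (b / 2) (k / 2)) e"
      have h: "h > 0" "h < b" "h < k" "h \<le> e" using b k e by (auto simp: h_def)
      let ?I = "{x - h..x + h}"
      have ID: "?I \<subseteq> ?D" using k(2) h(3) by (force simp: dist_real_def)
      define N where "N = E \<inter> ?I - B"
      define U where "U = (?I - E \<inter> ?I) \<union> N"
      have negN: "negligible N"
        unfolding N_def using E ID Em by (intro max) auto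
      have EI: "E \<inter> ?I \<in> lmeasurable"
        using Em by (rule lmeasurable_Int_interval)
      have dm: "?I - E \<inter> ?I \<in> lmeasurable" using EI by (intro fmeasurable.Diff) auto
      have Um: "U \<in> lmeasurable"
        unfolding U_def by (rule fmeasurable.Un[OF dm negligible_imp_measurable[OF negN]])
      have "measure lebesgue U \<le> measure lebesgue (?I - E \<inter> ?I) + measure lebesgue N"
        unfolding U_def using dm negN
        by (intro measure_Un_le fmeasurableD[OF dm] negligible_imp_sets[OF negN])
      also have "measure lebesgue N = 0" using negN by (rule negligible_imp_measure0)
      also have "measure lebesgue (?I - E \<inter> ?I) = measure lebesgue ?I - measure lebesgue (E \<inter> ?I)"
        using EI by (intro measurable_measure_Diff) auto
      also have "measure lebesgue ?I = 2 * h" using h by simp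
      finally have "measure lebesgue U \<le> 2 * h - measure lebesgue (E \<inter> ?I)" by simp
      also have "\<dots> < e * (2 * h)"
        using b(2)[OF h(1,2)] h(1) by (simp add: field_simps)
      also have "2 * h = measure lebesgue (ball x h)"
        using h(1) by (simp add: ball_eq_greaterThanLessThan)
      finally have "measure lebesgue U < e * measure lebesgue (ball x h)" .
      moreover have "(\<Union>K \<inter> ?D - B) \<inter> ball x h \<subseteq> U"
        by (auto simp: U_def N_def dist_real_def)
      ultimately show "\<exists>d U. 0 < d \<and> d \<le> e \<and> (\<Union>K \<inter> ?D - B) \<inter> ball x d \<subseteq> U \<and>
          U \<in> lmeasurable \<and> measure lebesgue U < e * measure lebesgue (ball x d)"
        using h Um by blast
    qed
    then have "B \<union> (\<Union>K \<inter> ?D - B) \<in> sets lebesgue"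
      using B(2) by (intro sets.Un) (auto simp: negligible_imp_sets)
    moreover have "B \<union> (\<Union>K \<inter> ?D - B) = \<Union>K \<inter> ?D" using B(1) by auto
    ultimately show ?thesis by simp
  qed
  have "(\<Union>n. \<Union>K \<inter> ball 0 (real n)) \<in> sets lebesgue"
    using meas by (intro sets.countable_UN) auto
  moreover have "\<exists>n. \<bar>x\<bar> < real n" for x :: real
    by (rule reals_Archimedean2)
  then have "(\<Union>n. \<Union>K \<inter> ball 0 (real n)) = \<Union>K"
    by (auto simp: dist_real_def)
  ultimately show ?thesis by simp
qed

lemma istopology_density_open: "istopology density_open"
  unfolding istopology_def
proof (intro conjI allI impI)
  show "density_open (E \<inter> F)" if "density_open E" "density_open F" for E F
    using that by (rule density_open_Int)
  fix K :: "real set set"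
  assume "\<forall>E\<in>K. density_open E"
  then have K: "\<And>E. E \<in> K \<Longrightarrow> density_open E" by blast
  note U = density_open_Union_measurable[OF K]
  moreover have "\<Union>K \<subseteq> density_points (\<Union>K)"
  proof
    fix x assume "x \<in> \<Union>K"
    then obtain E where E: "E \<in> K" "x \<in> E" by auto
    then have "x \<in> density_points E" "E \<in> sets lebesgue"
      using K[OF E(1)] by (auto simp: density_open_def)
    with density_points_mono[of E "\<Union>K"] E(1) U show "x \<in> density_points (\<Union>K)"
      by blast
  qed
  ultimately show "density_open (\<Union>K)"
    by (simp add: density_open_def)
qed

lemma openin_density_topology:
  "openin density_topology E \<longleftrightarrow> E \<in> sets lebesgue \<and> E \<subseteq> density_points E"
  by (simp add: density_topology_def istopology_density_open density_open_def)

lemma topspace_density_topology: "topspace density_topology = UNIV"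
proof -
  have "has_density UNIV 1 x" for x
    by (rule has_density_1I[where g = "\<lambda>_. 1"]) auto
  then have "openin density_topology UNIV"
    by (auto simp: openin_density_topology density_points_def)
  then show ?thesis
    using openin_subset by blast
qed


subsection \<open>Variants of pseudocompactness\<close>

definition pseudocompact_space :: "'a topology \<Rightarrow> bool" where
  "pseudocompact_space X \<longleftrightarrow>
     (\<forall>f :: 'a \<Rightarrow> real. continuous_map X euclideanreal f \<longrightarrow> bounded (f ` topspace X))"

definition weakly_hereditarily_pseudocompact :: "'a topology \<Rightarrow> bool" where
  "weakly_hereditarily_pseudocompact X \<longleftrightarrow>
     pseudocompact_space X \<and> (\<forall>C. closedin X C \<longrightarrow> pseudocompact_space (subtopology X C))"

definition nowhere_dense_in :: "'a topology \<Rightarrow> 'a set \<Rightarrow> bool" where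
  "nowhere_dense_in X S \<longleftrightarrow> S \<subseteq> topspace X \<and> X interior_of (X closure_of S) = {}"

text \<open>Pseudocompactness of the space itself is part of the definition and does not follow from the
  second conjunct: in an infinite discrete space only the empty set is nowhere dense.\<close>

definition N_pseudocompact :: "'a topology \<Rightarrow> bool" where
  "N_pseudocompact X \<longleftrightarrow>
     pseudocompact_space X \<and>
     (\<forall>S. nowhere_dense_in X S \<longrightarrow> pseudocompact_space (subtopology X S))"

definition hereditarily_pseudocompact :: "'a topology \<Rightarrow> bool" where
  "hereditarily_pseudocompact X \<longleftrightarrow> hereditarily pseudocompact_space X"

end

theory Submission
  imports Defs
begin

text \<open>
  A Lebesgue null set is closed in the density topology, and so are all its subsets; hence it is
  discrete as a subspace, and not pseudocompact if it is infinite. Every countably infinite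
  \<open>C \<subseteq> A\<close> therefore witnesses the failure of weak hereditary pseudocompactness. For
  \<open>N\<close>-pseudocompactness, \<open>A\<close> itself is the witness if it is null. Otherwise, the points of \<open>A\<close>
  having a density neighbourhood that meets \<open>A\<close> in a null set form a null set, so infinitely many
  points remain, and any countably infinite set of those is nowhere dense in \<open>A\<close>.
\<close>

lemma negligible_countable:
  fixes S :: "'a::euclidean_space set"
  assumes "countable S"
  shows "negligible S"
  using countable_imp_null_set_lborel[OF assms] null_sets_completionI
  by (auto simp: negligible_iff_null_sets)

text \<open>Removing a null set from an interval leaves its length unchanged, so the complement of
  \<open>N\<close> has density 1 at every real, in particular at its own points.\<close>

lemma closedin_density_topology_negligible:
  assumes "negligible N"
  shows "closedin density_topology N"
proof -
  have N: "N \<in> sets lebesgue"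
    using assms by (rule negligible_imp_sets)
  have "has_density (- N) 1 x" for x
  proof (rule has_density_1I[where g = "\<lambda>_. 1"])
    show "- N \<in> sets lebesgue"
      using sets.compl_sets[OF N] by (simp add: Compl_eq_Diff_UNIV)
    fix h :: real
    assume h: "h > 0"
    have "negligible (sym_diff (- N \<inter> {x - h..x + h}) {x - h..x + h})"
      by (rule negligible_subset[OF assms]) auto
    then have "measure lebesgue (- N \<inter> {x - h..x + h}) = measure lebesgue {x - h..x + h}"
      by (intro measure_negligible_symdiff) (auto simp: Un_commute)
    then show "1 \<le> measure lebesgue (- N \<inter> {x - h..x + h}) / (2 * h)"
      using h by simp
  qed simp
  then show ?thesis
    using sets.compl_sets[OF N]
    by (auto simp: closedin_def topspace_density_topology openin_density_topology
        density_points_def Compl_eq_Diff_UNIV)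
qed

text \<open>For each \<open>x\<close> in \<open>S\<close> the set \<open>S - {x}\<close> is again
  null, hence closed, and its complement isolates \<open>x\<close> within \<open>S\<close>.\<close>

lemma subtopology_density_topology_negligible:
  assumes "negligible S"
  shows "subtopology density_topology S = discrete_topology S"
proof -
  have "openin (subtopology density_topology S) {x}" if "x \<in> S" for x
  proof -
    have "closedin density_topology (S - {x})"
      using assms by (intro closedin_density_topology_negligible) (rule negligible_diff)
    then have "openin density_topology (- (S - {x}))"
      by (simp add: closedin_def topspace_density_topology Compl_eq_Diff_UNIV)
    moreover have "{x} = - (S - {x}) \<inter> S"
      using that by auto
    ultimately show ?thesis
      unfolding openin_subtopology by blast
  qed
  then have "discrete_topology S = subtopology density_topology S"
    by (subst discrete_topology_unique) (auto simp: topspace_density_topology)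
  then show ?thesis ..
qed

lemma pseudocompact_space_finite:
  assumes "finite (topspace X)"
  shows "pseudocompact_space X"
  using assms by (auto simp: pseudocompact_space_def intro: finite_imp_bounded)

lemma pseudocompact_space_discrete_topology:
  "pseudocompact_space (discrete_topology S) \<longleftrightarrow> finite S"
proof
  show "finite S" if pc: "pseudocompact_space (discrete_topology S)"
  proof (rule ccontr)
    assume "infinite S"
    then obtain g :: "nat \<Rightarrow> 'a" where g: "inj g" "range g \<subseteq> S"
      using infinite_countable_subset by blast
    \<comment> \<open>Continuity is automatic on a discrete space, so only the values
      \<open>f (g n) = n\<close> matter; off the range of \<open>g\<close> they are
      arbitrary.\<close>
    define f where "f x = real (inv g x)" for x
    have "bounded (f ` S)"
      using pc by (auto simp: pseudocompact_space_def)
    then obtain B where B: "\<And>x. x \<in> S \<Longrightarrow> \<bar>f x\<bar> \<le> B"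
      unfolding bounded_iff by auto
    obtain n :: nat where "B < real n"
      using reals_Archimedean2 by blast
    moreover have "f (g n) = real n"
      using g(1) by (simp add: f_def)
    moreover have "g n \<in> S"
      using g(2) by auto
    ultimately show False
      using B[of "g n"] by simp
  qed
qed (simp add: pseudocompact_space_finite)

lemma pseudocompact_space_negligible_iff_finite:
  assumes "negligible S"
  shows "pseudocompact_space (subtopology density_topology S) \<longleftrightarrow> finite S"
  using assms
  by (simp add: subtopology_density_topology_negligible pseudocompact_space_discrete_topology)

text \<open>The density topology is not Lindelof, so countably many \<open>U\<close> need not
  suffice. Instead, each point has density 0 in the set: near \<open>x\<close> almost everything
  lies in \<open>U\<close>, where \<open>A\<close> is null.\<close>

lemma negligible_locally_negligible_points:
  fixes A :: "real set"
  shows "negligible {x \<in> A. \<exists>U. openin density_topology U \<and> x \<in> U \<and> negligible (U \<inter> A)}"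
    (is "negligible ?Z")
proof (subst negligible_eq_zero_density_alt, intro ballI allI impI)
  fix x e :: real
  assume "x \<in> ?Z" and e: "e > 0"
  then obtain U where U: "openin density_topology U" "x \<in> U" and neg: "negligible (U \<inter> A)"
    by blast
  have Um: "U \<in> sets lebesgue"
    using U(1) by (simp add: openin_density_topology)
  have "((\<lambda>h. measure lebesgue (U \<inter> {x - h..x + h}) / (2 * h)) \<longlongrightarrow> 1) (at_right 0)"
    using U by (auto simp: openin_density_topology density_points_def has_density_def)
  then have "\<forall>\<^sub>F h in at_right 0. measure lebesgue (U \<inter> {x - h..x + h}) / (2 * h) > 1 - e"
    using e by (intro order_tendstoD) auto
  then obtain b where b: "b > 0"
    "\<And>h. 0 < h \<Longrightarrow> h < b \<Longrightarrow> measure lebesgue (U \<inter> {x - h..x + h}) / (2 * h) > 1 - e"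
    by (auto simp: eventually_at_right[OF zero_less_one])
  \<comment> \<open>Halving gives \<open>h < b\<close> strictly; the bound by \<open>e\<close> is
    demanded by the zero-density criterion.\<close>
  define h where "h = min (b / 2) e"
  have h: "h > 0" "h < b" "h \<le> e"
    using b(1) e by (auto simp: h_def)
  let ?I = "{x - h..x + h}"
  \<comment> \<open>A point of \<open>A\<close> in the interval either misses \<open>U\<close> or
    lies in the null set \<open>U \<inter> A\<close>, so \<open>?V\<close> covers what is
    needed.\<close>
  let ?V = "(?I - U \<inter> ?I) \<union> U \<inter> A"
  have UI: "U \<inter> ?I \<in> lmeasurable"
    using Um by (rule lmeasurable_Int_interval)
  have dm: "?I - U \<inter> ?I \<in> lmeasurable"
    using UI by (intro fmeasurable.Diff) auto
  have Vm: "?V \<in> lmeasurable"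
    by (rule fmeasurable.Un[OF dm negligible_imp_measurable[OF neg]])
  have "measure lebesgue ?V \<le> measure lebesgue (?I - U \<inter> ?I) + measure lebesgue (U \<inter> A)"
    by (intro measure_Un_le fmeasurableD[OF dm] negligible_imp_sets[OF neg])
  also have "\<dots> = 2 * h - measure lebesgue (U \<inter> ?I)"
    using h(1) UI by (simp add: negligible_imp_measure0[OF neg] measurable_measure_Diff)
  also have "\<dots> < e * (2 * h)"
    using b(2)[OF h(1,2)] h(1) by (simp add: field_simps)
  also have "2 * h = measure lebesgue (ball x h)"
    using h(1) by (simp add: ball_eq_greaterThanLessThan)
  finally have "measure lebesgue ?V < e * measure lebesgue (ball x h)" .
  moreover have "?Z \<inter> ball x h \<subseteq> ?V"
    by (auto simp: dist_real_def)
  ultimately show "\<exists>d V. 0 < d \<and> d \<le> e \<and> ?Z \<inter> ball x d \<subseteq> V \<and>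
      V \<in> lmeasurable \<and> measure lebesgue V < e * measure lebesgue (ball x d)"
    using h Vm by blast
qed

lemma infinite_nowhere_dense_negligible_subset:
  fixes A :: "real set"
  assumes "\<not> negligible A"
  obtains C where "infinite C" "negligible C" "C \<subseteq> A"
    "nowhere_dense_in (subtopology density_topology A) C"
proof -
  let ?X = "subtopology density_topology A"
  define Z where "Z = {x \<in> A. \<exists>U. openin density_topology U \<and> x \<in> U \<and> negligible (U \<inter> A)}"
  have "negligible Z"
    unfolding Z_def by (rule negligible_locally_negligible_points)
  \<comment> \<open>A finite remainder would be null, making \<open>A\<close> a union of two null
    sets.\<close>
  then have "infinite (A - Z)"
    using assms negligible_Un[of Z "A - Z"] negligible_finite[of "A - Z"]
      negligible_subset[of "Z \<union> (A - Z)" A] by blast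
  then obtain C where C: "C \<subseteq> A - Z" "infinite C" "countable C"
    using infinite_countable_subset' by blast
  have neg: "negligible C"
    using C(3) by (rule negligible_countable)
  have "closedin ?X C"
    using closedin_density_topology_negligible[OF neg] C(1) by (intro closedin_subset_topspace) auto
  then have closure: "?X closure_of C = C"
    by (simp add: closure_of_eq)
  have "?X interior_of C = {}"
  proof (rule ccontr)
    assume "?X interior_of C \<noteq> {}"
    then obtain x V where xV: "openin ?X V" "x \<in> V" "V \<subseteq> C"
      by (auto simp: interior_of_def)
    then obtain U where U: "openin density_topology U" "V = U \<inter> A"
      by (auto simp: openin_subtopology)
    \<comment> \<open>A nonempty relatively open \<open>V\<close> inside the null set
      \<open>C\<close> would put its points into \<open>Z\<close>, which \<open>C\<close>
      avoids.\<close>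
    have "negligible (U \<inter> A)"
      using xV(3) U(2) neg negligible_subset by blast
    then have "x \<in> Z"
      using U xV(2) by (auto simp: Z_def)
    then show False
      using xV C(1) by blast
  qed
  then have "nowhere_dense_in ?X C"
    using C(1) closure by (auto simp: nowhere_dense_in_def topspace_density_topology)
  then show thesis
    using that C neg by blast
qed

theorem theorem3p1:
  fixes A :: "real set"
  shows "let X = subtopology density_topology A in
           (weakly_hereditarily_pseudocompact X \<longleftrightarrow> N_pseudocompact X) \<and>
           (N_pseudocompact X \<longleftrightarrow> finite A) \<and>
           (hereditarily_pseudocompact X \<longleftrightarrow> N_pseudocompact X)"
proof -
  let ?X = "subtopology density_topology A"
  \<comment> \<open>Since \<open>C \<subseteq> A\<close>, the subspace of \<open>?X\<close> on
    \<open>C\<close> is the subspace of the whole line, where the discrete criterion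
    applies.\<close>
  have not_pc: "\<not> pseudocompact_space (subtopology ?X C)"
    if "infinite C" "negligible C" "C \<subseteq> A" for C
    using that pseudocompact_space_negligible_iff_finite[of C]
    by (simp add: subtopology_subtopology Int_absorb1)
  have pc: "pseudocompact_space ?X" "pseudocompact_space (subtopology ?X C)" if "finite A" for C
    using that by (auto intro!: pseudocompact_space_finite simp: topspace_density_topology)
  have fin: "weakly_hereditarily_pseudocompact ?X" "N_pseudocompact ?X"
    "hereditarily_pseudocompact ?X" if "finite A"
    using pc[OF that] by (auto simp: weakly_hereditarily_pseudocompact_def N_pseudocompact_def
        hereditarily_pseudocompact_def hereditarily_def)
  have inf: "\<not> weakly_hereditarily_pseudocompact ?X \<and> \<not> N_pseudocompact ?X \<and>
    \<not> hereditarily_pseudocompact ?X" if A: "infinite A"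
  proof (intro conjI)
    obtain C where C: "C \<subseteq> A" "infinite C" "countable C"
      using infinite_countable_subset'[OF A] by blast
    have neg: "negligible C"
      using C(3) by (rule negligible_countable)
    have "closedin ?X C"
      using closedin_density_topology_negligible[OF neg] C(1)
      by (intro closedin_subset_topspace) auto
    then show "\<not> weakly_hereditarily_pseudocompact ?X"
      using not_pc[OF C(2) neg C(1)] by (auto simp: weakly_hereditarily_pseudocompact_def)
    show "\<not> hereditarily_pseudocompact ?X"
      using not_pc[OF C(2) neg C(1)] C(1)
      by (auto simp: hereditarily_pseudocompact_def hereditarily_def topspace_density_topology)
    show "\<not> N_pseudocompact ?X"
    \<comment> \<open>If \<open>A\<close> is null, \<open>?X\<close> is discrete and only the empty
      set is nowhere dense, so the failure must come from \<open>?X\<close> itself.\<close>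
    proof (cases "negligible A")
      case True
      then show ?thesis
        using A by (simp add: N_pseudocompact_def pseudocompact_space_negligible_iff_finite)
    next
      case False
      then show ?thesis
        using not_pc infinite_nowhere_dense_negligible_subset[OF False]
        unfolding N_pseudocompact_def by metis
    qed
  qed
  show ?thesis
    using fin inf by (auto simp: Let_def)
qed

end
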